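(* Let $Z_n$ be the number of zeros of a random lattice path $P_n$ of length $n$ (chosen according to the model in the context). Then, as $n\to\infty$, $$\mathbb{E}(Z_n)=\frac12\log n+\frac{\gamma+\log2}{2}+\frac{1+[n\text{ even}]}{2n}-\frac{2+9[n\text{ even}]}{12n^2}+\frac{[n\text{ even}]}{n^3}+O\Bigl(\frac1{n^4}\Bigr).$$
   Context: $[\mathit{expr}]$ is $1$ if $\mathit{expr}$ is true and $0$ otherwise; $\log$ is the natural logarithm; $\gamma$ is the Euler--Mascheroni constant. Random path model: for an integer $n\ge0$, a random path $P_n$ on the lattice $\mathbb{Z}^2$ with steps $(1,+1)$ and $(1,-1)$, ending in $(n,0)$, is chosen as follows. First choose a starting point $(0,S)$ with $S$ uniformly distributed in $\{-n,-n+2,\dots,n-2,n\}$. Then choose a path uniformly at random among all paths from $(0,S)$ to $(n,0)$. A zero of $P_n$ is a lattice point $(x,0)\in P_n$ visited by the path (including the starting point if $S=0$ and the end point $(n,0)$). *)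

theory Defs
  imports "HOL-Probability.Probability"
begin

text \<open>A lattice path of length \<open>n\<close> with steps \<open>(1,+1)\<close> and \<open>(1,-1)\<close>, starting on the line
  \<open>x = 0\<close>, is represented by the list of its \<open>n + 1\<close> heights: entry \<open>x\<close> of the list is the
  height \<open>y\<close> of the lattice point \<open>(x,y)\<close> on the path.\<close>

definition lattice_paths :: "nat \<Rightarrow> int \<Rightarrow> int list set" where
  "lattice_paths n s =
     {p. length p = n + 1 \<and> p ! 0 = s \<and> p ! n = 0 \<and> (\<forall>i<n. p ! (i + 1) - p ! i \<in> {1, -1})}"

definition start_heights :: "nat \<Rightarrow> int set" where
  "start_heights n = {- int n + 2 * int k | k. k \<le> n}"

definition random_path :: "nat \<Rightarrow> int list pmf" where
  "random_path n = bind_pmf (pmf_of_set (start_heights n)) (\<lambda>s. pmf_of_set (lattice_paths n s))"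

definition num_zeros :: "int list \<Rightarrow> nat" where
  "num_zeros p = card {x. x < length p \<and> p ! x = 0}"

text \<open>The uniform distributions used above are over finite nonempty sets, as \<open>pmf_of_set\<close> requires.\<close>

lemma finite_start_heights: "finite (start_heights n)"
  by (simp add: start_heights_def)

lemma start_heights_nonempty: "start_heights n \<noteq> {}"
  by (auto simp: start_heights_def)

lemma lattice_path_bound:
  assumes "p \<in> lattice_paths n s" "i \<le> n"
  shows "\<bar>p ! i - s\<bar> \<le> int i"
  using assms(2)
proof (induction i)
  case 0
  then show ?case using assms(1) by (simp add: lattice_paths_def)
next
  case (Suc i)
  then have "p ! (i + 1) - p ! i \<in> {1, -1}"
    using assms(1) by (auto simp: lattice_paths_def)
  with Suc show ?case by auto
qed

lemma finite_lattice_paths: "finite (lattice_paths n s)"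
proof (rule finite_subset)
  show "lattice_paths n s \<subseteq> {p. set p \<subseteq> {s - int n..s + int n} \<and> length p = n + 1}"
  proof
    fix p assume p: "p \<in> lattice_paths n s"
    then have len: "length p = n + 1" by (simp add: lattice_paths_def)
    have "y \<in> {s - int n..s + int n}" if "y \<in> set p" for y
    proof -
      from that obtain i where i: "i < length p" "p ! i = y" by (auto simp: in_set_conv_nth)
      then have "i \<le> n" using len by simp
      with lattice_path_bound[OF p this] i show ?thesis by auto
    qed
    with len show "p \<in> {p. set p \<subseteq> {s - int n..s + int n} \<and> length p = n + 1}" by blast
  qed
  show "finite {p. set p \<subseteq> {s - int n..s + int n} \<and> length p = n + 1}"
    by (rule finite_lists_length_eq) simp
qed

lemma lattice_paths_nonempty:
  assumes "s \<in> start_heights n"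
  shows "lattice_paths n s \<noteq> {}"
proof -
  from assms obtain k where k: "k \<le> n" "s = - int n + 2 * int k"
    by (auto simp: start_heights_def)
  define h where "h i = (if i \<le> k then s - int i else s - 2 * int k + int i)" for i
  have "map h [0..<n + 1] \<in> lattice_paths n s"
    using k by (auto simp: lattice_paths_def h_def nth_append simp del: upt_Suc)
  then show ?thesis by blast
qed

end

theory Submission
  imports Defs "HOL-Real_Asymp.Real_Asymp"
begin

text \<open>Deleting the starting point of a random path of length \<open>n + 1\<close> yields a random path of length
  \<open>n\<close>, because of the identity
  \<open>1 / (n+1 choose k) + 1 / (n+1 choose k+1) = (n+2) / (n+1) / (n choose k)\<close> (the consistency
  of Polya's urn). Hence \<open>E(Z\<^sub>n\<^sub>+\<^sub>1) - E(Z\<^sub>n)\<close> is the probability \<open>[n+1 even] / (n+2)\<close> of starting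
  at height \<open>0\<close>, so that \<open>E(Z\<^sub>n)\<close> is the sum of the \<open>1 / (2l+1)\<close> over \<open>l \<le> n div 2\<close>. The constant of
  the asymptotic expansion of this sum comes from the harmonic numbers; its error term is read off
  from its increments, which are explicit functions.\<close>

section \<open>The exact expectation\<close>

lemma num_zeros_conv_filter: "num_zeros p = length (filter (\<lambda>y. y = 0) p)"
  by (simp add: num_zeros_def length_filter_conv_card)

lemma num_zeros_Cons: "num_zeros (y # p) = of_bool (y = 0) + num_zeros p"
  by (simp add: num_zeros_conv_filter)

section \<open>First-step decomposition and counting of paths\<close>

lemma lattice_paths_0: "lattice_paths 0 s = (if s = 0 then {[0]} else {})"
  by (auto simp: lattice_paths_def length_Suc_conv)

lemma Cons_in_lattice_paths_Suc_iff:
  "y # p \<in> lattice_paths (Suc n) s \<longleftrightarrow>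
     y = s \<and> (p \<in> lattice_paths n (s + 1) \<or> p \<in> lattice_paths n (s - 1))"
  by (auto simp: lattice_paths_def All_less_Suc2)

lemma lattice_paths_Suc:
  "lattice_paths (Suc n) s = (#) s ` (lattice_paths n (s + 1) \<union> lattice_paths n (s - 1))"
proof -
  have "p \<noteq> []" if "p \<in> lattice_paths (Suc n) s" for p
    using that by (auto simp: lattice_paths_def)
  then have "p \<in> lattice_paths (Suc n) s \<longleftrightarrow>
      p \<in> (#) s ` (lattice_paths n (s + 1) \<union> lattice_paths n (s - 1))" for p
    by (cases p) (auto simp: Cons_in_lattice_paths_Suc_iff)
  then show ?thesis by blast
qed

lemma lattice_paths_disjoint: "s \<noteq> t \<Longrightarrow> lattice_paths n s \<inter> lattice_paths n t = {}"
  by (auto simp: lattice_paths_def)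

lemma lattice_paths_eq_empty:
  assumes "\<bar>s\<bar> > int n"
  shows "lattice_paths n s = {}"
proof (rule equals0I)
  fix p assume p: "p \<in> lattice_paths n s"
  then have "p ! n = 0" by (simp add: lattice_paths_def)
  with lattice_path_bound[OF p order_refl] assms show False by simp
qed

lemma sum_lattice_paths_Suc:
  "sum f (lattice_paths (Suc n) s) =
     (\<Sum>p\<in>lattice_paths n (s + 1). f (s # p)) + (\<Sum>p\<in>lattice_paths n (s - 1). f (s # p))"
  unfolding lattice_paths_Suc
  by (subst sum.reindex)
     (auto simp: sum.union_disjoint finite_lattice_paths lattice_paths_disjoint)

text \<open>The index \<open>k\<close> is the number of down-steps of a path from height
  \<open>2 * k - n\<close> to \<open>0\<close>. A first step up leaves \<open>k\<close> of them, a
  first step down leaves \<open>k - 1\<close>, so Pascal's rule applies. For \<open>k > n\<close>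
  both sides are zero.\<close>

lemma card_lattice_paths: "card (lattice_paths n (2 * int k - int n)) = n choose k"
proof (induction n arbitrary: k)
  case 0
  then show ?case by (auto simp: lattice_paths_0)
next
  case (Suc n)
  have up: "2 * int k - int (Suc n) + 1 = 2 * int k - int n" by simp
  show ?case
  proof (cases k)
    case 0
    have "card (lattice_paths (Suc n) (2 * int k - int (Suc n))) =
        card (lattice_paths n (2 * int k - int n))"
      \<comment> \<open>With \<open>k = 0\<close> a first step down would lead to height
        \<open>- n - 2\<close>, from which \<open>0\<close> is out of reach in \<open>n\<close>
        steps.\<close>
      using sum_lattice_paths_Suc[of "\<lambda>_. 1 :: nat" n "2 * int k - int (Suc n)", unfolded up] 0
      by (simp add: lattice_paths_eq_empty)
    with Suc.IH[of k] 0 show ?thesis by simp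
  next
    case (Suc j)
    have down: "2 * int k - int (Suc n) - 1 = 2 * int j - int n" using Suc by simp
    show ?thesis
      using sum_lattice_paths_Suc[of "\<lambda>_. 1 :: nat" n "2 * int k - int (Suc n)", unfolded up down]
        Suc.IH[of k] Suc.IH[of j] Suc
      by simp
  qed
qed

section \<open>Averaging over the starting height\<close>

lemma sum_start_heights: "sum f (start_heights n) = (\<Sum>k\<le>n. f (2 * int k - int n))"
proof -
  have "start_heights n = (\<lambda>k. 2 * int k - int n) ` {..n}"
    by (auto simp: start_heights_def)
  moreover have "inj_on (\<lambda>k. 2 * int k - int n) {..n}"
    by (auto intro: inj_onI)
  ultimately show ?thesis by (simp add: sum.reindex)
qed

lemma card_start_heights: "card (start_heights n) = n + 1"
  using sum_start_heights[of "\<lambda>_. 1 :: nat" n] by simp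

lemma expectation_random_path:
  fixes f :: "int list \<Rightarrow> real"
  shows "measure_pmf.expectation (random_path n) f =
    (\<Sum>k\<le>n. sum f (lattice_paths n (2 * int k - int n)) / real (n choose k)) / real (n + 1)"
proof -
  have "measure_pmf.expectation (random_path n) f =
      (\<Sum>s\<in>start_heights n. pmf (pmf_of_set (start_heights n)) s *\<^sub>R
         measure_pmf.expectation (pmf_of_set (lattice_paths n s)) f)"
    unfolding random_path_def
    by (rule pmf_expectation_bind)
       (auto simp: finite_start_heights start_heights_nonempty finite_lattice_paths
          lattice_paths_nonempty)
  also have "\<dots> = (\<Sum>s\<in>start_heights n. sum f (lattice_paths n s) / card (lattice_paths n s) / real (n + 1))"
    by (intro sum.cong refl)
       (simp add: pmf_of_set finite_start_heights start_heights_nonempty finite_lattice_paths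
          lattice_paths_nonempty card_start_heights integral_pmf_of_set)
  also have "\<dots> = (\<Sum>k\<le>n. sum f (lattice_paths n (2 * int k - int n)) / real (n choose k) / real (n + 1))"
    by (simp only: sum_start_heights card_lattice_paths)
  finally show ?thesis by (simp only: sum_divide_distrib)
qed

text \<open>Absorption writes \<open>Suc n * (n choose k)\<close> as
  \<open>Suc k * (Suc n choose Suc k)\<close> and, after reflecting \<open>k\<close> to
  \<open>n - k\<close>, also as \<open>(n - k + 1) * (Suc n choose k)\<close>. Over this common
  denominator the numerators \<open>k + 1\<close> and \<open>n - k + 1\<close> add up to
  \<open>n + 2\<close>.\<close>

lemma inverse_binomial_add:
  assumes "k \<le> n"
  shows "1 / real (Suc n choose k) + 1 / real (Suc n choose Suc k) =
    real (n + 2) / (real (n + 1) * real (n choose k))"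
proof -
  have a: "real (Suc n) * real (n choose k) = real (Suc k) * real (Suc n choose Suc k)"
    using Suc_times_binomial_eq[of n k] by (metis mult.commute of_nat_mult)
  have "Suc n choose k = Suc n choose Suc (n - k)"
    using assms binomial_symmetric[of k "Suc n"] by (simp add: Suc_diff_le)
  then have "real (Suc n) * real (n choose k) = real (Suc (n - k)) * real (Suc n choose k)"
    using Suc_times_binomial_eq[of n "n - k"] binomial_symmetric[OF assms]
    by (metis mult.commute of_nat_mult)
  then have b: "real (Suc n) * real (n choose k) = (real n - real k + 1) * real (Suc n choose k)"
    using assms by (simp add: of_nat_diff add.commute)
  have pos: "real (Suc n choose k) > 0" "real (Suc n choose Suc k) > 0" "real (n choose k) > 0"
    using assms by (simp_all del: binomial_Suc_Suc)
  have "1 / real (Suc n choose k) = (real n - real k + 1) / (real (Suc n) * real (n choose k))"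
    using b pos assms by (simp add: divide_simps del: binomial_Suc_Suc)
  moreover have "1 / real (Suc n choose Suc k) = real (Suc k) / (real (Suc n) * real (n choose k))"
    unfolding a using pos by (simp add: divide_simps del: binomial_Suc_Suc)
  ultimately show ?thesis
    by (simp add: add_divide_distrib[symmetric] del: binomial_Suc_Suc)
qed

lemma expectation_num_zeros_Suc:
  "measure_pmf.expectation (random_path (Suc n)) (\<lambda>p. real (num_zeros p)) =
     measure_pmf.expectation (random_path n) (\<lambda>p. real (num_zeros p)) + of_bool (odd n) / real (n + 2)"
proof -
  define A where "A n k = (\<Sum>p\<in>lattice_paths n (2 * int k - int n). real (num_zeros p))" for n k
  \<comment> \<open>\<open>B k\<close> accounts for a first step down, which uses up one of the
    \<open>k\<close> down-steps. The case \<open>k = 0\<close> is separate because truncated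
    subtraction would give \<open>A n 0\<close> instead of \<open>0\<close>.\<close>
  define B where "B k = (if k = 0 then 0 else A n (k - 1))" for k
  have A_top: "A n (Suc n) = 0"
    by (simp add: A_def lattice_paths_eq_empty)
  have A_Suc: "A (Suc n) k =
      A n k + B k + of_bool (2 * k = Suc n) * real (Suc n choose k)" for k
  proof -
    define s where "s = 2 * int k - int (Suc n)"
    have up: "s + 1 = 2 * int k - int n" by (simp add: s_def)
    have "A (Suc n) k = (\<Sum>p\<in>lattice_paths (Suc n) s. real (num_zeros p))"
      by (simp add: A_def s_def)
    \<comment> \<open>The prepended point is a zero exactly if \<open>s = 0\<close>, and then it
      counts once for each path from \<open>s\<close>.\<close>
    also have "\<dots> = (\<Sum>p\<in>lattice_paths n (s + 1). real (num_zeros p))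
        + (\<Sum>p\<in>lattice_paths n (s - 1). real (num_zeros p))
        + of_bool (s = 0) * real (card (lattice_paths n (s + 1)) + card (lattice_paths n (s - 1)))"
      by (simp add: sum_lattice_paths_Suc num_zeros_Cons sum.distrib)
    also have "card (lattice_paths n (s + 1)) + card (lattice_paths n (s - 1)) = Suc n choose k"
      using sum_lattice_paths_Suc[of "\<lambda>_. 1 :: nat" n s] card_lattice_paths[of "Suc n" k]
      by (simp add: s_def)
    also have "(\<Sum>p\<in>lattice_paths n (s + 1). real (num_zeros p)) = A n k"
      by (simp add: A_def up)
    also have "(\<Sum>p\<in>lattice_paths n (s - 1). real (num_zeros p)) = B k"
    proof (cases k)
      case 0
      then show ?thesis by (simp add: B_def s_def lattice_paths_eq_empty)
    next
      case (Suc j)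
      then have "s - 1 = 2 * int j - int n" by (simp add: s_def)
      then show ?thesis by (simp add: B_def A_def Suc)
    qed
    also have "s = 0 \<longleftrightarrow> 2 * k = Suc n" by (auto simp: s_def)
    finally show ?thesis .
  qed
  have "(\<Sum>k\<le>Suc n. A (Suc n) k / real (Suc n choose k)) =
      (\<Sum>k\<le>Suc n. A n k / real (Suc n choose k)) + (\<Sum>k\<le>Suc n. B k / real (Suc n choose k))
      + (\<Sum>k\<le>Suc n. of_bool (2 * k = Suc n))"
    unfolding sum.distrib[symmetric]
    by (intro sum.cong refl) (auto simp: A_Suc add_divide_distrib simp del: binomial_Suc_Suc)
  \<comment> \<open>The top term of the first sum and the bottom term of the second vanish. After an
    index shift both sums run over the same \<open>A n k\<close>, so
    \<open>inverse_binomial_add\<close> can merge their weights.\<close>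
  also have "(\<Sum>k\<le>Suc n. A n k / real (Suc n choose k)) = (\<Sum>k\<le>n. A n k / real (Suc n choose k))"
    by (simp add: A_top)
  also have "(\<Sum>k\<le>Suc n. B k / real (Suc n choose k)) = (\<Sum>k\<le>n. A n k / real (Suc n choose Suc k))"
    by (simp add: sum.atMost_Suc_shift B_def del: sum.atMost_Suc binomial_Suc_Suc)
  also have "(\<Sum>k\<le>n. A n k / real (Suc n choose k)) + (\<Sum>k\<le>n. A n k / real (Suc n choose Suc k)) =
      (\<Sum>k\<le>n. A n k * (1 / real (Suc n choose k) + 1 / real (Suc n choose Suc k)))"
    by (simp add: sum.distrib distrib_left del: binomial_Suc_Suc)
  also have "\<dots> = (\<Sum>k\<le>n. A n k * (real (n + 2) / (real (n + 1) * real (n choose k))))"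
    by (intro sum.cong refl) (simp only: inverse_binomial_add atMost_iff)
  also have "\<dots> = real (n + 2) * ((\<Sum>k\<le>n. A n k / real (n choose k)) / real (n + 1))"
    by (simp add: sum_distrib_left sum_divide_distrib mult_ac)
  also have "(\<Sum>k\<le>Suc n. of_bool (2 * k = Suc n)) = (of_bool (odd n) :: real)"
  proof (cases "odd n")
    case True
    then obtain j where "n = 2 * j + 1" by (auto elim: oddE)
    then have "2 * k = Suc n \<longleftrightarrow> k = j + 1" for k by auto
    then show ?thesis using True \<open>n = 2 * j + 1\<close> by (simp add: of_bool_def)
  next
    case False
    then have "2 * k \<noteq> Suc n" for k by presburger
    then show ?thesis using False by simp
  qed
  finally show ?thesis
    unfolding expectation_random_path A_def
    by (simp add: add_divide_distrib del: sum.atMost_Suc binomial_Suc_Suc)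
qed

text \<open>The recursion changes the value only from an odd \<open>n\<close> to
  \<open>n + 1\<close>, and there \<open>n + 2 = 2 * (n div 2 + 1) + 1\<close> is the next odd
  denominator.\<close>

lemma expectation_num_zeros:
  "measure_pmf.expectation (random_path n) (\<lambda>p. real (num_zeros p)) =
     (\<Sum>l\<le>n div 2. 1 / real (2 * l + 1))"
proof (induction n)
  case 0
  then show ?case
    by (simp add: expectation_random_path lattice_paths_0 num_zeros_conv_filter)
next
  case (Suc n)
  show ?case
  proof (cases "odd n")
    case True
    then have "Suc n div 2 = Suc (n div 2)" "real (2 * Suc (n div 2) + 1) = real (n + 2)"
      by (auto elim: oddE)
    with True Suc show ?thesis
      by (simp only: expectation_num_zeros_Suc sum.atMost_Suc) simp
  next
    case False
    then have "Suc n div 2 = n div 2" by simp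
    with False Suc show ?thesis
      by (simp add: expectation_num_zeros_Suc)
  qed
qed

section \<open>Asymptotics\<close>

text \<open>If the increments of \<open>d\<close> are bounded by
  \<open>c * (g n - g (Suc n))\<close>, then \<open>c * g + d\<close> and \<open>c * g - d\<close>
  are both eventually decreasing with limit \<open>0\<close>, hence nonnegative. The sign is
  \<open>e\<close> in the proof.\<close>

lemma bigo_telescope:
  fixes d g :: "nat \<Rightarrow> real"
  assumes "d \<longlonglongrightarrow> 0" "g \<longlonglongrightarrow> 0"
    and g_dec: "eventually (\<lambda>n. g (Suc n) \<le> g n) at_top"
    and "(\<lambda>n. d (Suc n) - d n) \<in> O(\<lambda>n. g n - g (Suc n))"
  shows "d \<in> O(g)"
proof -
  from assms(4) obtain c where c: "c > 0" and
    d: "eventually (\<lambda>n. \<bar>d (Suc n) - d n\<bar> \<le> c * \<bar>g n - g (Suc n)\<bar>) at_top"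
    by (auto elim!: landau_o.bigE)
  from g_dec d have "eventually (\<lambda>n. \<bar>d (Suc n) - d n\<bar> \<le> c * (g n - g (Suc n))) at_top"
    by eventually_elim simp
  then obtain N where N: "\<bar>d (Suc n) - d n\<bar> \<le> c * (g n - g (Suc n))" if "n \<ge> N" for n
    by (auto simp: eventually_at_top_linorder)
  have "\<bar>d n\<bar> \<le> c * g n" if "n \<ge> N" for n
  proof -
    have lim: "(\<lambda>k. c * g (n + k) + e * d (n + k)) \<longlonglongrightarrow> 0" for e
    proof -
      have "(\<lambda>k. c * g (k + n) + e * d (k + n)) \<longlonglongrightarrow> c * 0 + e * 0"
        by (intro tendsto_intros LIMSEQ_ignore_initial_segment assms)
      then show ?thesis by (simp add: add.commute)
    qed
    have "0 \<le> c * g n + e * d n" if "e \<in> {1, -1}" for e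
    proof -
      have "decseq (\<lambda>k. c * g (n + k) + e * d (n + k))"
      proof (rule decseq_SucI)
        fix k
        show "c * g (n + Suc k) + e * d (n + Suc k) \<le> c * g (n + k) + e * d (n + k)"
          using N[of "n + k"] \<open>n \<ge> N\<close> that by (auto simp: algebra_simps abs_le_iff)
      qed
      from decseq_ge[OF this lim, of 0] show ?thesis by simp
    qed
    from this[of 1] this[of "-1"] show ?thesis by simp
  qed
  moreover have "c * g n \<le> c * norm (g n)" for n
    using c by simp
  ultimately have "eventually (\<lambda>n. norm (d n) \<le> c * norm (g n)) at_top"
    unfolding eventually_at_top_linorder real_norm_def by (meson order_trans)
  then show ?thesis by (rule bigoI)
qed

text \<open>The even denominators up to \<open>2 * m + 1\<close> contribute half of
  \<open>harm m\<close>.\<close>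

lemma sum_inverse_odd:
  "(\<Sum>l\<le>m. 1 / real (2 * l + 1)) = harm (2 * m + 1) - harm m / 2"
proof (induction m)
  case 0
  show ?case by (simp add: harm_expand)
next
  case (Suc m)
  have "2 * Suc m + 1 = Suc (Suc (2 * m + 1))" by simp
  moreover have "inverse (real (Suc (2 * m + 1))) = inverse (real (Suc m)) / 2"
    by (simp add: field_simps)
  ultimately show ?case
    using Suc
    by (simp only: sum.atMost_Suc harm_Suc) (simp add: inverse_eq_divide add_divide_distrib)
qed

text \<open>The claimed expansion for even \<open>n\<close>, as a function of a real
  variable.\<close>

definition odd_sum_approx :: "real \<Rightarrow> real" where
  "odd_sum_approx x = ln x / 2 + (euler_mascheroni + ln 2) / 2 + 1 / x - 11 / (12 * x ^ 2) + 1 / x ^ 3"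

text \<open>Only the convergence to \<open>0\<close> involves the Euler-Mascheroni constant; in the
  increments it cancels, and what remains is elementary.\<close>

lemma sum_inverse_odd_approx:
  "(\<lambda>m. (\<Sum>l\<le>m. 1 / real (2 * l + 1)) - odd_sum_approx (real (2 * m))) \<in> O(\<lambda>m. 1 / real m ^ 4)"
proof (rule bigo_telescope)
  have h: "(\<lambda>m. harm m - ln (real m)) \<longlonglongrightarrow> (euler_mascheroni :: real)"
    by (rule euler_mascheroni_LIMSEQ)
  have "filterlim (\<lambda>m::nat. 2 * m + 1) at_top at_top" by real_asymp
  note h2 = filterlim_compose[OF h this]
  \<comment> \<open>All logarithms cancel in the limit. The remaining
    \<open>- euler_mascheroni / 2\<close> offsets what the two harmonic numbers contribute.\<close>
  have "(\<lambda>m. ln (2 * real m + 1) - ln (real m) / 2 - odd_sum_approx (real (2 * m)))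
      \<longlonglongrightarrow> - euler_mascheroni / 2"
    unfolding odd_sum_approx_def by (real_asymp simp: field_simps)
  then
  have "(\<lambda>m. (harm (2 * m + 1) - ln (real (2 * m + 1))) - (harm m - ln (real m)) / 2
      + (ln (2 * real m + 1) - ln (real m) / 2 - odd_sum_approx (real (2 * m))))
      \<longlonglongrightarrow> euler_mascheroni - euler_mascheroni / 2 + - euler_mascheroni / 2"
    by (intro tendsto_intros h h2) auto
  then show "(\<lambda>m. (\<Sum>l\<le>m. 1 / real (2 * l + 1)) - odd_sum_approx (real (2 * m))) \<longlonglongrightarrow> 0"
    unfolding sum_inverse_odd by (simp add: diff_divide_distrib algebra_simps)
  show "(\<lambda>m. 1 / real m ^ 4) \<longlonglongrightarrow> 0" by real_asymp
  show "eventually (\<lambda>m. 1 / real (Suc m) ^ 4 \<le> 1 / real m ^ 4) at_top"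
    using eventually_gt_at_top[of 0] by eventually_elim (auto intro!: divide_left_mono power_mono)
  have "(\<lambda>m. 1 / real (2 * Suc m + 1) - odd_sum_approx (real (2 * Suc m)) + odd_sum_approx (real (2 * m)))
      \<in> O(\<lambda>m. 1 / real m ^ 4 - 1 / real (Suc m) ^ 4)"
    unfolding odd_sum_approx_def by real_asymp
  then show "(\<lambda>m. ((\<Sum>l\<le>Suc m. 1 / real (2 * l + 1)) - odd_sum_approx (real (2 * Suc m))) -
      ((\<Sum>l\<le>m. 1 / real (2 * l + 1)) - odd_sum_approx (real (2 * m))))
      \<in> O(\<lambda>m. 1 / real m ^ 4 - 1 / real (Suc m) ^ 4)"
    by (simp add: algebra_simps)
qed

theorem corollaryD2:
  shows "(\<lambda>n::nat. measure_pmf.expectation (random_path n) (\<lambda>p. real (num_zeros p))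
            - (1 / 2 * ln (real n) + (euler_mascheroni + ln 2) / 2
               + (1 + of_bool (even n)) / (2 * real n)
               - (2 + 9 * of_bool (even n)) / (12 * real n ^ 2)
               + of_bool (even n) / real n ^ 3))
         \<in> O(\<lambda>n. 1 / real n ^ 4)"
proof -
  define target where "target n = 1 / 2 * ln (real n) + (euler_mascheroni + ln 2) / 2
               + (1 + of_bool (even n)) / (2 * real n)
               - (2 + 9 * of_bool (even n)) / (12 * real n ^ 2)
               + of_bool (even n) / real n ^ 3" for n
  \<comment> \<open>For odd \<open>n\<close>, \<open>2 * (n div 2) = n - 1\<close>. This is the
    resulting discrepancy with the odd case of \<open>target\<close>, free of parity so that it can
    be expanded in \<open>x\<close>. For even \<open>n\<close> the discrepancy is zero.\<close>
  define odd_diff where "odd_diff x = odd_sum_approx (x - 1) -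
    (ln x / 2 + (euler_mascheroni + ln 2) / 2 + 1 / (2 * x) - 2 / (12 * x ^ 2))" for x :: real
  have "filterlim (\<lambda>n::nat. n div 2) at_top at_top"
    by (rule filterlim_at_top_div_const_nat) simp
  from landau_o.big.compose[OF sum_inverse_odd_approx this]
  have "(\<lambda>n. (\<Sum>l\<le>n div 2. 1 / real (2 * l + 1)) - odd_sum_approx (real (2 * (n div 2))))
      \<in> O(\<lambda>n. 1 / real (n div 2) ^ 4)" .
  also have "(\<lambda>n. 1 / real (n div 2) ^ 4) \<in> O(\<lambda>n. 1 / real n ^ 4)"
  proof (rule bigoI)
    \<comment> \<open>The constant is \<open>4 ^ 4\<close>, from
      \<open>n \<le> 4 * (n div 2)\<close> for \<open>n \<ge> 2\<close>.\<close>
    show "eventually (\<lambda>n. norm (1 / real (n div 2) ^ 4) \<le> 256 * norm (1 / real n ^ 4)) at_top"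
      using eventually_ge_at_top[of 2]
    proof eventually_elim
      case (elim n)
      then have "n \<le> 4 * (n div 2)" by linarith
      then have "real n ^ 4 \<le> (4 * real (n div 2)) ^ 4" by (intro power_mono) linarith+
      with elim show ?case by (simp add: power_mult_distrib divide_simps)
    qed
  qed
  finally have main: "(\<lambda>n. (\<Sum>l\<le>n div 2. 1 / real (2 * l + 1)) - odd_sum_approx (real (2 * (n div 2))))
      \<in> O(\<lambda>n. 1 / real n ^ 4)" .
  have "(\<lambda>n. odd_sum_approx (real (2 * (n div 2))) - target n) \<in> O(\<lambda>n. odd_diff (real n))"
  proof (rule bigoI)
    show "eventually (\<lambda>n. norm (odd_sum_approx (real (2 * (n div 2))) - target n)
        \<le> 1 * norm (odd_diff (real n))) at_top"
    proof (rule always_eventually, rule allI)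
      fix n
      show "norm (odd_sum_approx (real (2 * (n div 2))) - target n) \<le> 1 * norm (odd_diff (real n))"
      proof (cases "even n")
        case True
        then show ?thesis by (simp add: target_def odd_sum_approx_def)
      next
        case False
        then have "real (2 * (n div 2)) = real n - 1" by (auto elim: oddE)
        then show ?thesis unfolding target_def odd_diff_def using False by simp
      qed
    qed
  qed
  also have "(\<lambda>n. odd_diff (real n)) \<in> O(\<lambda>n. 1 / real n ^ 4)"
    unfolding odd_diff_def odd_sum_approx_def by real_asymp
  finally have "(\<lambda>n. odd_sum_approx (real (2 * (n div 2))) - target n) \<in> O(\<lambda>n. 1 / real n ^ 4)" .
  from sum_in_bigo(1)[OF main this] show ?thesis
    unfolding expectation_num_zeros target_def[symmetric] by simp
qed

end
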